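(* Let $A=(A,\mu,\alpha,\beta)$ be a bihom-associative algebra over a field $\mathbb{K}$ of characteristic zero. If $H^2_{\mathrm{Hoch}}(A,A)=0$, then $A$ is rigid, i.e. every $1$-parameter formal deformation of $A$ is equivalent to the trivial deformation $\mu_t=\mu$.
   Context: A bihom-associative algebra $(A,\mu,\alpha,\beta)$ is a vector space $A$ with a bilinear map $\mu:A\times A\to A$ and two commuting linear maps $\alpha,\beta:A\to A$ such that $\alpha(\mu(a,b))=\mu(\alpha(a),\alpha(b))$, $\beta(\mu(a,b))=\mu(\beta(a),\beta(b))$ and $\mu(\alpha(a),\mu(b,c))=\mu(\mu(a,b),\beta(c))$ for all $a,b,c\in A$. For $n\ge1$, $C^n_{\mathrm{Hoch}}(A,A)$ is the space of linear maps $f:A^{\otimes n}\to A$ with $\alpha\circ f=f\circ\alpha^{\otimes n}$ and $\beta\circ f=f\circ\beta^{\otimes n}$, with coboundary $$(\delta_{\mathrm{Hoch}}f)(a_1,\dots,a_{n+1})=\mu(\alpha^{n-1}(a_1),f(a_2,\dots,a_{n+1}))+\sum_{i=1}^n(-1)^if(\alpha(a_1),\dots,\alpha(a_{i-1}),\mu(a_i,a_{i+1}),\beta(a_{i+2}),\dots,\beta(a_{n+1}))+(-1)^{n+1}\mu(f(a_1,\dots,a_n),\beta^{n-1}(a_{n+1})).$$ $H^\bullet_{\mathrm{Hoch}}(A,A)$ is the cohomology of this complex. A $1$-parameter formal deformation of $A$ is a $\mathbb{K}[[t]]$-bilinear map $\mu_t:A[[t]]\times A[[t]]\to A[[t]]$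 of the form $\mu_t=\sum_{i\ge0}\mu_it^i$ with all $\mu_i\in C^2_{\mathrm{Hoch}}(A,A)$, $\mu_0=\mu$, and $\mu_t(\alpha(a),\mu_t(b,c))=\mu_t(\mu_t(a,b),\beta(c))$ for all $a,b,c\in A$. Two deformations $\mu_t,\mu_t'$ are equivalent if there is a formal automorphism $\phi_t=\sum_{i\ge0}\phi_it^i:A[[t]]\to A[[t]]$ with $\phi_i\in C^1_{\mathrm{Hoch}}(A,A)$, $\phi_0=\mathrm{id}$, such that $\phi_t(\mu_t(a,b))=\mu_t'(\phi_t(a),\phi_t(b))$ for all $a,b\in A$. *)

theory Defs
  imports "HOL-Computational_Algebra.Formal_Power_Series"
begin

locale bihom_assoc_algebra = vector_space scale
  for scale :: "'k::field \<Rightarrow> 'a::ab_group_add \<Rightarrow> 'a" +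
  fixes mu :: "'a \<Rightarrow> 'a \<Rightarrow> 'a" and alpha beta :: "'a \<Rightarrow> 'a"
  assumes linear_mu_left: "Vector_Spaces.linear scale scale (\<lambda>a. mu a b)"
    and linear_mu_right: "Vector_Spaces.linear scale scale (mu a)"
    and linear_alpha: "Vector_Spaces.linear scale scale alpha"
    and linear_beta: "Vector_Spaces.linear scale scale beta"
    and alpha_beta_commute: "alpha (beta a) = beta (alpha a)"
    and alpha_mu: "alpha (mu a b) = mu (alpha a) (alpha b)"
    and beta_mu: "beta (mu a b) = mu (beta a) (beta b)"
    and bihom_assoc: "mu (alpha a) (mu b c) = mu (mu a b) (beta c)"
begin

text \<open>
  A linear map on the \<open>n\<close>-th tensor power is represented by the corresponding
  \<open>n\<close>-linear function on lists of length \<open>n\<close>, extended by zero to lists of all other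
  lengths, so that distinct functions represent distinct maps.
\<close>

definition cochains :: "nat \<Rightarrow> ('a list \<Rightarrow> 'a) set" where
  "cochains n = {f.
     (\<forall>xs. length xs \<noteq> n \<longrightarrow> f xs = 0) \<and>
     (\<forall>xs i. length xs = n \<longrightarrow> i < n \<longrightarrow>
        Vector_Spaces.linear scale scale (\<lambda>x. f (xs[i := x]))) \<and>
     (\<forall>xs. length xs = n \<longrightarrow> alpha (f xs) = f (map alpha xs)) \<and>
     (\<forall>xs. length xs = n \<longrightarrow> beta (f xs) = f (map beta xs))}"

text \<open>
  Coboundary of an \<open>n\<close>-cochain, \<open>n \<ge> 1\<close>. The arguments \<open>a\<^sub>1, \<dots>, a\<^sub>n\<^sub>+\<^sub>1\<close> form the list
  \<open>xs\<close>, so \<open>a\<^sub>i\<close> is \<open>xs ! (i - 1)\<close>.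
\<close>

definition coboundary :: "nat \<Rightarrow> ('a list \<Rightarrow> 'a) \<Rightarrow> 'a list \<Rightarrow> 'a" where
  "coboundary n f xs =
     (if length xs = n + 1 then
        mu ((alpha ^^ (n - 1)) (hd xs)) (f (tl xs))
        + (\<Sum>i = 1..n. scale ((-1) ^ i)
             (f (map alpha (take (i - 1) xs) @ [mu (xs ! (i - 1)) (xs ! i)]
                 @ map beta (drop (i + 1) xs))))
        + scale ((-1) ^ (n + 1)) (mu (f (butlast xs)) ((beta ^^ (n - 1)) (last xs)))
      else 0)"

definition cocycles :: "nat \<Rightarrow> ('a list \<Rightarrow> 'a) set" where
  "cocycles n = {f \<in> cochains n. coboundary n f = (\<lambda>_. 0)}"

text \<open>The complex starts in degree 1, so there are no nonzero coboundaries in degree 1.\<close>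

definition coboundaries :: "nat \<Rightarrow> ('a list \<Rightarrow> 'a) set" where
  "coboundaries n =
     (if n \<le> 1 then {\<lambda>_. 0} else coboundary (n - 1) ` cochains (n - 1))"

definition cohomologous :: "nat \<Rightarrow> (('a list \<Rightarrow> 'a) \<times> ('a list \<Rightarrow> 'a)) set" where
  "cohomologous n = {(f, g). f \<in> cocycles n \<and> g \<in> cocycles n \<and>
     (\<lambda>xs. f xs - g xs) \<in> coboundaries n}"

definition Hoch_cohomology :: "nat \<Rightarrow> ('a list \<Rightarrow> 'a) set set" where
  "Hoch_cohomology n = cocycles n // cohomologous n"

definition Hoch_cohomology_zero :: "nat \<Rightarrow> ('a list \<Rightarrow> 'a) set" where
  "Hoch_cohomology_zero n = cohomologous n `` {\<lambda>_. 0}"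

text \<open>
  \<open>A[[t]]\<close> is the type \<open>'a fps\<close>, with the following action of \<open>K[[t]]\<close>; an element
  of \<open>A\<close> is regarded as an element of \<open>A[[t]]\<close> by \<open>fps_const\<close>.
\<close>

definition fps_scale :: "'k fps \<Rightarrow> 'a fps \<Rightarrow> 'a fps" where
  "fps_scale c x = Abs_fps (\<lambda>n. \<Sum>i\<le>n. scale (fps_nth c i) (fps_nth x (n - i)))"

definition fps_bilinear :: "('a fps \<Rightarrow> 'a fps \<Rightarrow> 'a fps) \<Rightarrow> bool" where
  "fps_bilinear M \<longleftrightarrow>
     (\<forall>y. module_hom fps_scale fps_scale (\<lambda>x. M x y)) \<and>
     (\<forall>x. module_hom fps_scale fps_scale (M x))"

text \<open>
  The condition that \<open>M\<close> is of the form \<open>\<Sum>i. \<mu>\<^sub>i t\<^sup>i\<close> is imposed on \<open>A\<close>; it determines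
  \<open>M\<close> on \<open>A[[t]]\<close>, since \<open>K[[t]]\<close>-bilinear maps are continuous for the \<open>t\<close>-adic topology.
\<close>

definition formal_deformation :: "('a fps \<Rightarrow> 'a fps \<Rightarrow> 'a fps) \<Rightarrow> bool" where
  "formal_deformation M \<longleftrightarrow>
     fps_bilinear M \<and>
     (\<exists>m. (\<forall>i. m i \<in> cochains 2) \<and>
          (\<forall>a b. m 0 [a, b] = mu a b) \<and>
          (\<forall>a b. M (fps_const a) (fps_const b) = Abs_fps (\<lambda>i. m i [a, b]))) \<and>
     (\<forall>a b c. M (fps_const (alpha a)) (M (fps_const b) (fps_const c)) =
              M (M (fps_const a) (fps_const b)) (fps_const (beta c)))"

definition formal_automorphism :: "('a fps \<Rightarrow> 'a fps) \<Rightarrow> bool" where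
  "formal_automorphism \<phi> \<longleftrightarrow>
     module_hom fps_scale fps_scale \<phi> \<and> bij \<phi> \<and>
     (\<exists>p. (\<forall>i. p i \<in> cochains 1) \<and>
          (\<forall>a. p 0 [a] = a) \<and>
          (\<forall>a. \<phi> (fps_const a) = Abs_fps (\<lambda>i. p i [a])))"

definition equivalent_deformations ::
    "('a fps \<Rightarrow> 'a fps \<Rightarrow> 'a fps) \<Rightarrow> ('a fps \<Rightarrow> 'a fps \<Rightarrow> 'a fps) \<Rightarrow> bool" where
  "equivalent_deformations M M' \<longleftrightarrow>
     formal_deformation M \<and> formal_deformation M' \<and>
     (\<exists>\<phi>. formal_automorphism \<phi> \<and>
          (\<forall>a b. \<phi> (M (fps_const a) (fps_const b)) =
                 M' (\<phi> (fps_const a)) (\<phi> (fps_const b))))"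

text \<open>The \<open>K[[t]]\<close>-bilinear extension of \<open>mu\<close> to \<open>A[[t]]\<close>.\<close>

definition trivial_deformation :: "'a fps \<Rightarrow> 'a fps \<Rightarrow> 'a fps" where
  "trivial_deformation x y =
     Abs_fps (\<lambda>n. \<Sum>i\<le>n. mu (fps_nth x i) (fps_nth y (n - i)))"

definition rigid :: bool where
  "rigid \<longleftrightarrow>
     (\<forall>M. formal_deformation M \<longrightarrow> equivalent_deformations M trivial_deformation)"

end

end

theory Submission
  imports Defs
begin

text \<open>
  Let \<open>M = \<Sum>i. m\<^sub>i t\<^sup>i\<close> be a deformation. A formal automorphism \<open>\<phi> = \<Sum>i. p\<^sub>i t\<^sup>i\<close> with
  \<open>p\<^sub>0 = id\<close> transports \<open>M\<close> to the constant product exactly when the defect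
  \<open>E(x, y) = \<phi>(M(x, y)) - \<phi>(x) \<cdot> \<phi>(y)\<close> vanishes, and the \<open>p\<^sub>n\<close> are chosen one order at a
  time. Changing \<open>p\<^sub>n\<close> from \<open>0\<close> to \<open>r\<close> lowers the coefficient \<open>E\<^sub>n\<close> by the
  Hochschild coboundary of \<open>r\<close>, so it suffices that \<open>E\<^sub>n\<close> is a 2-cocycle once all lower
  coefficients vanish: since \<open>H\<^sup>2 = 0\<close>, it is then a coboundary and some \<open>r\<close> removes it.

  The cocycle identity (lemma \<open>defect_lowest_coeff_cocycle\<close>) comes from expanding
  \<open>\<phi>(M(\<alpha>(a), M(b, c))) = \<phi>(M(M(a, b), \<beta>(c)))\<close> twice with
  \<open>\<phi>(M(x, y)) = E(x, y) + \<phi>(x) \<cdot> \<phi>(y)\<close>. The two triple products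
  \<open>\<phi>(\<alpha>(a)) \<cdot> (\<phi>(b) \<cdot> \<phi>(c))\<close> and \<open>(\<phi>(a) \<cdot> \<phi>(b)) \<cdot> \<phi>(\<beta>(c))\<close> agree, because \<open>\<phi>\<close>
  commutes with the structure maps and the constant product is bihom-associative. What
  remains is
  \<open>E(\<alpha>(a), M(b, c)) + \<phi>(\<alpha>(a)) \<cdot> E(b, c) = E(M(a, b), \<beta>(c)) + E(a, b) \<cdot> \<phi>(\<beta>(c))\<close>,
  and its coefficient of order \<open>n\<close> involves only \<open>E\<^sub>n\<close>, the constant terms
  \<open>M\<^sub>0 = \<mu>\<close> and \<open>p\<^sub>0 = id\<close>. Working with the defect of \<open>\<phi>\<close> avoids inverting
  \<open>\<phi>\<close> and replacing \<open>M\<close> by a conjugate at each order.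

  To read off coefficients one needs \<open>K[[t]]\<close>-linear maps to be determined by their values
  on constants (lemma \<open>fps_linear_nth\<close>). The map \<open>\<phi>\<close> is bijective because its
  coefficients form a triangular system with identity diagonal.
\<close>

section \<open>Multilinear maps and cochains of low degree\<close>

context bihom_assoc_algebra
begin

abbreviation klinear :: "('a \<Rightarrow> 'a) \<Rightarrow> bool" where
  "klinear \<equiv> Vector_Spaces.linear scale scale"

lemma klinear_iff:
  "klinear f \<longleftrightarrow> (\<forall>x y. f (x + y) = f x + f y) \<and> (\<forall>c x. f (scale c x) = scale c (f x))"
  unfolding Vector_Spaces.linear_iff using vector_space_axioms by blast

lemma klinear_sum: "klinear f \<Longrightarrow> f (sum g S) = (\<Sum>i\<in>S. f (g i))"
  by (simp add: linear_iff_module_hom module_hom.sum)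

lemma klinear_zero: "klinear f \<Longrightarrow> f 0 = 0"
  by (simp add: linear_iff_module_hom module_hom.zero)

lemma klinear_diff: "klinear f \<Longrightarrow> f (x - y) = f x - f y"
  by (simp add: linear_iff_module_hom module_hom.diff)

lemma klinear_compose: "klinear f \<Longrightarrow> klinear g \<Longrightarrow> klinear (\<lambda>x. f (g x))"
  by (simp add: klinear_iff)

lemma klinear_diffI: "klinear f \<Longrightarrow> klinear g \<Longrightarrow> klinear (\<lambda>x. f x - g x)"
  by (simp add: klinear_iff scale_right_diff_distrib)

lemma klinear_sumI: "(\<And>i. i \<in> S \<Longrightarrow> klinear (f i)) \<Longrightarrow> klinear (\<lambda>x. \<Sum>i\<in>S. f i x)"
  by (simp add: klinear_iff sum.distrib scale_sum_right)

lemma mu_zero [simp]: "mu 0 b = 0" "mu a 0 = 0"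
  using klinear_zero[OF linear_mu_left] klinear_zero[OF linear_mu_right] by auto

text \<open>
  Curried forms of 1- and 2-cochains: every cochain in these degrees arises from such a map
  by extension by zero to lists of the wrong length.
\<close>

definition equivariant1 :: "('a \<Rightarrow> 'a) \<Rightarrow> bool" where
  "equivariant1 f \<longleftrightarrow> klinear f \<and>
     (\<forall>a. alpha (f a) = f (alpha a)) \<and> (\<forall>a. beta (f a) = f (beta a))"

definition equivariant2 :: "('a \<Rightarrow> 'a \<Rightarrow> 'a) \<Rightarrow> bool" where
  "equivariant2 F \<longleftrightarrow> (\<forall>b. klinear (\<lambda>a. F a b)) \<and> (\<forall>a. klinear (F a)) \<and>
     (\<forall>a b. alpha (F a b) = F (alpha a) (alpha b)) \<and>
     (\<forall>a b. beta (F a b) = F (beta a) (beta b))"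

definition cochain1 :: "('a \<Rightarrow> 'a) \<Rightarrow> 'a list \<Rightarrow> 'a" where
  "cochain1 f xs = (if length xs = 1 then f (xs ! 0) else 0)"

definition cochain2 :: "('a \<Rightarrow> 'a \<Rightarrow> 'a) \<Rightarrow> 'a list \<Rightarrow> 'a" where
  "cochain2 F xs = (if length xs = 2 then F (xs ! 0) (xs ! 1) else 0)"

lemma cochain1_in: "equivariant1 f \<Longrightarrow> cochain1 f \<in> cochains 1"
  by (auto simp: cochains_def cochain1_def equivariant1_def)

lemma cochain2_in:
  assumes "equivariant2 F"
  shows "cochain2 F \<in> cochains 2"
proof -
  have "klinear (\<lambda>x. cochain2 F (xs[i := x]))" if "length xs = 2" "i < 2" for xs i
  proof -
    from that have "i = 0 \<or> i = 1" by auto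
    with that assms show ?thesis
      by (auto simp: cochain2_def equivariant2_def)
  qed
  with assms show ?thesis
    by (auto simp: cochains_def cochain2_def equivariant2_def)
qed

lemma equivariant1_cochain:
  assumes "p \<in> cochains 1"
  shows "equivariant1 (\<lambda>a. p [a])"
proof -
  have "klinear (\<lambda>x. p ([undefined][0 := x]))"
    using assms unfolding cochains_def mem_Collect_eq by (metis One_nat_def length_Cons list.size(3) lessI)
  with assms show ?thesis
    by (auto simp: equivariant1_def cochains_def)
qed

lemma equivariant2_cochain:
  assumes "m \<in> cochains 2"
  shows "equivariant2 (\<lambda>a b. m [a, b])"
proof -
  have *: "klinear (\<lambda>x. m (xs[i := x]))" if "length xs = 2" "i < 2" for xs i
    using assms that unfolding cochains_def by auto
  have "klinear (\<lambda>a. m [a, b])" for b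
    using *[of "[undefined, b]" 0] by simp
  moreover have "klinear (\<lambda>b. m [a, b])" for a
    using *[of "[a, undefined]" 1] by simp
  ultimately show ?thesis
    using assms by (auto simp: equivariant2_def cochains_def)
qed

lemma equivariant1_zero: "equivariant1 (\<lambda>_. 0)"
  using klinear_zero[OF linear_alpha] klinear_zero[OF linear_beta]
  by (simp add: equivariant1_def klinear_iff)

lemma equivariant2_zero: "equivariant2 (\<lambda>_ _. 0)"
  using klinear_zero[OF linear_alpha] klinear_zero[OF linear_beta]
  by (simp add: equivariant2_def klinear_iff)

lemma equivariant1_id: "equivariant1 (\<lambda>a. a)"
  by (simp add: equivariant1_def klinear_iff)

lemma equivariant2_mu: "equivariant2 mu"
  by (simp add: equivariant2_def linear_mu_left linear_mu_right alpha_mu beta_mu)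

lemma equivariant2_diff:
  "equivariant2 F \<Longrightarrow> equivariant2 G \<Longrightarrow> equivariant2 (\<lambda>a b. F a b - G a b)"
  using klinear_diff[OF linear_alpha] klinear_diff[OF linear_beta]
  by (simp add: equivariant2_def klinear_diffI)

lemma equivariant2_sum:
  "(\<And>i. i \<in> S \<Longrightarrow> equivariant2 (F i)) \<Longrightarrow> equivariant2 (\<lambda>a b. \<Sum>i\<in>S. F i a b)"
  by (simp add: equivariant2_def klinear_sumI klinear_sum[OF linear_alpha] klinear_sum[OF linear_beta])

lemma equivariant2_compose:
  "equivariant1 f \<Longrightarrow> equivariant2 F \<Longrightarrow> equivariant2 (\<lambda>a b. f (F a b))"
  by (auto simp: equivariant1_def equivariant2_def intro: klinear_compose)

lemma equivariant2_mu_compose: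
  "equivariant1 f \<Longrightarrow> equivariant1 g \<Longrightarrow> equivariant2 (\<lambda>a b. mu (f a) (g b))"
  by (auto simp: equivariant1_def equivariant2_def alpha_mu beta_mu
      intro: klinear_compose[OF linear_mu_left] klinear_compose[OF linear_mu_right])

lemma coboundary_1:
  "coboundary 1 f [a, b] = mu a (f [b]) - f [mu a b] + mu (f [a]) b"
  by (simp add: coboundary_def)

lemma coboundary_cochain2:
  "coboundary 2 (cochain2 F) [a, b, c] =
     mu (alpha a) (F b c) - F (mu a b) (beta c) + F (alpha a) (mu b c) - mu (F a b) (beta c)"
  by (simp add: coboundary_def cochain2_def numeral_2_eq_2 power2_eq_square)

lemma cochain2_cocycleI:
  assumes "equivariant2 F"
    and "\<And>a b c. mu (alpha a) (F b c) + F (alpha a) (mu b c) = mu (F a b) (beta c) + F (mu a b) (beta c)"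
  shows "cochain2 F \<in> cocycles 2"
proof -
  have "coboundary 2 (cochain2 F) xs = 0" for xs
  proof (cases "length xs = 3")
    case True
    then obtain a b c where "xs = [a, b, c]"
      by (auto simp: numeral_3_eq_3 length_Suc_conv)
    then show ?thesis
      using assms(2)[of a b c] by (simp only: coboundary_cochain2) (simp add: algebra_simps)
  next
    case False
    then show ?thesis by (simp add: coboundary_def)
  qed
  with assms show ?thesis
    by (simp add: cocycles_def cochain2_in fun_eq_iff)
qed

text \<open>
  The form in which the vanishing of the cohomology is used: the class of \<open>F\<close> is the
  class of \<open>0\<close>, so \<open>F\<close> differs from \<open>0\<close> by a coboundary.
\<close>

lemma coboundary_if_cohomology_trivial:
  assumes H: "Hoch_cohomology 2 = {Hoch_cohomology_zero 2}"
    and F: "equivariant2 F"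
      "\<And>a b c. mu (alpha a) (F b c) + F (alpha a) (mu b c) = mu (F a b) (beta c) + F (mu a b) (beta c)"
  obtains g where "equivariant1 g" "\<And>a b. F a b = mu a (g b) + mu (g a) b - g (mu a b)"
proof -
  have "cochain2 F \<in> cocycles 2"
    using F by (rule cochain2_cocycleI)
  then have "cohomologous 2 `` {cochain2 F} \<in> Hoch_cohomology 2"
    unfolding Hoch_cohomology_def by (rule quotientI)
  then have cls: "cohomologous 2 `` {cochain2 F} = cohomologous 2 `` {\<lambda>_. 0}"
    unfolding H by (simp add: Hoch_cohomology_zero_def)
  \<comment> \<open>The class of \<open>0\<close> contains \<open>0\<close>; hence so does the class of \<open>F\<close>, which relates
      \<open>F\<close> to \<open>0\<close> without appeal to symmetry of the relation.\<close>
  have zero2: "(\<lambda>_. 0) \<in> cocycles 2"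
    using cochain2_cocycleI[OF equivariant2_zero] by (simp add: cochain2_def [abs_def])
  have zero1: "(\<lambda>_. 0) \<in> cochains 1"
    using cochain1_in[OF equivariant1_zero] by (simp add: cochain1_def [abs_def])
  have "coboundary 1 (\<lambda>_. 0) = (\<lambda>_. 0)"
    by (simp add: coboundary_def fun_eq_iff)
  then have "(\<lambda>_. 0) \<in> coboundaries 2"
    using zero1 by (simp add: coboundaries_def image_iff) metis
  with zero2 have "(\<lambda>_. 0) \<in> cohomologous 2 `` {\<lambda>_. 0}"
    by (simp add: cohomologous_def)
  then have "cochain2 F \<in> coboundaries 2"
    unfolding cls[symmetric] by (simp add: cohomologous_def)
  then obtain f where f: "f \<in> cochains 1" "cochain2 F = coboundary 1 f"
    by (auto simp: coboundaries_def)
  show thesis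
  proof
    show "equivariant1 (\<lambda>a. f [a])"
      using f(1) by (rule equivariant1_cochain)
    show "F a b = mu a (f [b]) + mu (f [a]) b - f [mu a b]" for a b
      using fun_cong[OF f(2), of "[a, b]"] by (simp only: coboundary_1) (simp add: cochain2_def)
  qed
qed

section \<open>Linear maps over formal power series\<close>

text \<open>The \<open>K[[t]]\<close>-linear extension of \<open>\<Sum>i. P\<^sub>i t\<^sup>i\<close> when all \<open>P\<^sub>i\<close> are linear.\<close>

definition fps_extend :: "(nat \<Rightarrow> 'a \<Rightarrow> 'a) \<Rightarrow> 'a fps \<Rightarrow> 'a fps" where
  "fps_extend P x = Abs_fps (\<lambda>n. \<Sum>i\<le>n. P i (fps_nth x (n - i)))"

abbreviation fps_linear :: "('a fps \<Rightarrow> 'a fps) \<Rightarrow> bool" where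
  "fps_linear \<equiv> module_hom fps_scale fps_scale"

lemma fps_extend_nth: "fps_nth (fps_extend P x) n = (\<Sum>i\<le>n. P i (fps_nth x (n - i)))"
  by (simp add: fps_extend_def)

lemma fps_scale_nth:
  "fps_nth (fps_scale c x) n = (\<Sum>i\<le>n. scale (fps_nth c i) (fps_nth x (n - i)))"
  by (simp add: fps_scale_def)

lemma trivial_deformation_nth:
  "fps_nth (trivial_deformation x y) n = (\<Sum>i\<le>n. mu (fps_nth x i) (fps_nth y (n - i)))"
  by (simp add: trivial_deformation_def)

lemma triangle_sum_assoc:
  fixes f :: "nat \<Rightarrow> nat \<Rightarrow> nat \<Rightarrow> 'a"
  shows "(\<Sum>j\<le>n. \<Sum>i\<le>j. f i (j - i) (n - j)) = (\<Sum>j\<le>n. \<Sum>i\<le>n - j. f j i (n - j - i))"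
  using fps_mult_assoc_lemma[of f n n] by (simp add: atMost_atLeast0)

lemma triangle_sum_swap:
  fixes f :: "nat \<Rightarrow> nat \<Rightarrow> 'a"
  shows "(\<Sum>i\<le>n. \<Sum>j\<le>n - i. f i j) = (\<Sum>j\<le>n. \<Sum>i\<le>n - j. f i j)"
proof -
  have "{..n - i} = {j \<in> {..n}. i + j \<le> n}" "{..n - i} = {j \<in> {..n}. j + i \<le> n}" if "i \<le> n" for i
    using that by auto
  then show ?thesis
    using sum.swap_restrict[of "{..n}" "{..n}" f "\<lambda>i j. i + j \<le> n"] by simp
qed

lemma module_fps_scale: "module fps_scale"
proof
  fix c d :: "'k fps" and x y :: "'a fps"
  show "fps_scale c (x + y) = fps_scale c x + fps_scale c y"
    by (simp add: fps_eq_iff fps_scale_nth scale_right_distrib sum.distrib)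
  show "fps_scale (c + d) x = fps_scale c x + fps_scale d x"
    by (simp add: fps_eq_iff fps_scale_nth scale_left_distrib sum.distrib)
  show "fps_scale c (fps_scale d x) = fps_scale (c * d) x"
    using triangle_sum_assoc[of "\<lambda>i j k. scale (fps_nth c i * fps_nth d j) (fps_nth x k)"]
    by (simp add: fps_eq_iff fps_scale_nth fps_mult_nth scale_sum_right scale_sum_left atLeast0AtMost)
  have "(\<Sum>i\<le>n. scale (fps_nth 1 i) (fps_nth x (n - i))) = fps_nth x n" for n
  proof -
    have "(\<Sum>i\<le>n. scale (fps_nth 1 i) (fps_nth x (n - i))) = (\<Sum>i\<le>n. if i = 0 then fps_nth x n else 0)"
      by (rule sum.cong) auto
    then show ?thesis by simp
  qed
  then show "fps_scale 1 x = x"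
    by (simp add: fps_eq_iff fps_scale_nth)
qed

lemma fps_linear_iff:
  "fps_linear T \<longleftrightarrow> (\<forall>x y. T (x + y) = T x + T y) \<and> (\<forall>c x. T (fps_scale c x) = fps_scale c (T x))"
  by (simp add: module_hom_iff module_fps_scale)

lemma fps_linear_extend:
  assumes "\<And>i. klinear (P i)"
  shows "fps_linear (fps_extend P)"
proof -
  have P: "P i (x + y) = P i x + P i y" "P i (scale c x) = scale c (P i x)" for i c x y
    using assms by (auto simp: klinear_iff)
  have "fps_extend P (fps_scale c x) = fps_scale c (fps_extend P x)" for c x
  proof (rule fps_ext)
    fix n
    show "fps_nth (fps_extend P (fps_scale c x)) n = fps_nth (fps_scale c (fps_extend P x)) n"
      using triangle_sum_swap[of "\<lambda>i j. scale (fps_nth c j) (P i (fps_nth x (n - i - j)))" n]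
      by (simp add: fps_scale_nth fps_extend_nth klinear_sum[OF assms] P scale_sum_right add.commute)
  qed
  then show ?thesis
    by (simp add: fps_linear_iff fps_eq_iff fps_extend_nth P sum.distrib)
qed

lemma fps_scale_X_power_nth:
  "fps_nth (fps_scale (fps_X ^ k) x) n = (if n < k then 0 else fps_nth x (n - k))"
proof -
  have "fps_nth (fps_scale (fps_X ^ k) x) n = (\<Sum>i\<le>n. if i = k then fps_nth x (n - k) else 0)"
    unfolding fps_scale_nth by (rule sum.cong) (auto simp: fps_X_power_nth)
  then show ?thesis by auto
qed

text \<open>
  Modulo \<open>t\<^sup>n\<^sup>+\<^sup>1\<close>, a series is a finite combination of constants with coefficients
  \<open>t\<^sup>j\<close>. The remainder is a multiple of \<open>t\<^sup>n\<^sup>+\<^sup>1\<close> and stays one under a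
  \<open>K[[t]]\<close>-linear map, so linearity alone gives \<open>t\<close>-adic continuity.
\<close>

lemma fps_linear_nth:
  assumes "fps_linear T"
  shows "fps_nth (T x) n = (\<Sum>j\<le>n. fps_nth (T (fps_const (fps_nth x j))) (n - j))"
proof -
  let ?r = "Abs_fps (\<lambda>k. fps_nth x (k + Suc n))"
  have x: "x = (\<Sum>j\<le>n. fps_scale (fps_X ^ j) (fps_const (fps_nth x j))) + fps_scale (fps_X ^ Suc n) ?r"
  proof (rule fps_ext)
    fix k
    have "(\<Sum>j\<le>n. fps_nth (fps_scale (fps_X ^ j) (fps_const (fps_nth x j))) k)
        = (\<Sum>j\<le>n. if j = k then fps_nth x k else 0)"
      by (rule sum.cong) (auto simp: fps_scale_X_power_nth)
    then show "fps_nth x k = fps_nth ((\<Sum>j\<le>n. fps_scale (fps_X ^ j) (fps_const (fps_nth x j)))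
        + fps_scale (fps_X ^ Suc n) ?r) k"
      by (auto simp: fps_sum_nth fps_scale_X_power_nth simp del: power_Suc)
  qed
  have "T x = (\<Sum>j\<le>n. fps_scale (fps_X ^ j) (T (fps_const (fps_nth x j))))
      + fps_scale (fps_X ^ Suc n) (T ?r)"
    using arg_cong[OF x, of T]
    by (simp only: module_hom.add[OF assms] module_hom.sum[OF assms] module_hom.scale[OF assms])
  then show ?thesis
    by (simp add: fps_sum_nth fps_scale_X_power_nth del: power_Suc)
qed

lemma fps_extend_const: "fps_extend P (fps_const a) = Abs_fps (\<lambda>n. P n a)" if "\<And>i. klinear (P i)"
proof (rule fps_ext)
  fix n
  have "fps_nth (fps_extend P (fps_const a)) n = (\<Sum>i\<le>n. if i = n then P n a else 0)"
    unfolding fps_extend_nth by (rule sum.cong) (auto simp: klinear_zero[OF that])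
  then show "fps_nth (fps_extend P (fps_const a)) n = fps_nth (Abs_fps (\<lambda>n. P n a)) n"
    by simp
qed

text \<open>
  The equation \<open>fps_extend P x = y\<close> determines the coefficient \<open>x\<^sub>n\<close> from \<open>y\<^sub>n\<close> and
  the lower coefficients of \<open>x\<close>, so it has exactly one solution.
\<close>

lemma bij_fps_extend:
  assumes lin: "\<And>i. klinear (P i)" and P0: "P 0 = (\<lambda>a. a)"
  shows "bij (fps_extend P)"
proof (rule bijI)
  have split: "fps_nth (fps_extend P x) n = fps_nth x n + (\<Sum>i=1..n. P i (fps_nth x (n - i)))" for x n
    by (simp add: fps_extend_nth atMost_atLeast0 sum.atLeast_Suc_atMost P0)
  show "inj (fps_extend P)"
  proof (rule injI, rule fps_ext)
    fix x y n
    assume eq: "fps_extend P x = fps_extend P y"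
    show "fps_nth x n = fps_nth y n"
    proof (induction n rule: less_induct)
      case (less n)
      have "(\<Sum>i=1..n. P i (fps_nth x (n - i))) = (\<Sum>i=1..n. P i (fps_nth y (n - i)))"
        by (rule sum.cong) (auto simp: less.IH)
      with eq split[of x n] split[of y n] show ?case by simp
    qed
  qed
  show "surj (fps_extend P)"
    unfolding surj_def
  proof
    fix y
    have "\<exists>f. \<forall>n. f n = fps_nth y n - (\<Sum>i=1..n. P i (f (n - i)))"
    proof (rule dependent_wf_choice[OF wf_less_than])
      fix f g :: "nat \<Rightarrow> 'a" and n r
      assume "\<And>k. (k, n) \<in> less_than \<Longrightarrow> f k = g k"
      then have "(\<Sum>i=1..n. P i (f (n - i))) = (\<Sum>i=1..n. P i (g (n - i)))"
        by (intro sum.cong) auto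
      then show "(r = fps_nth y n - (\<Sum>i=1..n. P i (f (n - i)))) =
          (r = fps_nth y n - (\<Sum>i=1..n. P i (g (n - i))))" by simp
    qed (rule exI, rule refl)
    then obtain f where f: "\<And>n. f n = fps_nth y n - (\<Sum>i=1..n. P i (f (n - i)))" by blast
    have "fps_nth y n = fps_nth (fps_extend P (Abs_fps f)) n" for n
      using f[of n] by (simp add: split)
    then have "y = fps_extend P (Abs_fps f)"
      by (rule fps_ext)
    then show "\<exists>x. y = fps_extend P x" by blast
  qed
qed

text \<open>
  In either argument the constant product is an instance of \<open>fps_extend\<close>, from which it
  inherits \<open>K[[t]]\<close>-linearity.
\<close>

lemma trivial_deformation_left: "trivial_deformation x = fps_extend (\<lambda>i. mu (fps_nth x i))"
  by (simp add: fun_eq_iff fps_eq_iff trivial_deformation_nth fps_extend_nth)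

lemma trivial_deformation_right:
  "(\<lambda>x. trivial_deformation x y) = fps_extend (\<lambda>i a. mu a (fps_nth y i))"
proof -
  have "(\<Sum>i\<le>n. mu (fps_nth x i) (fps_nth y (n - i))) = (\<Sum>i\<le>n. mu (fps_nth x (n - i)) (fps_nth y i))"
    for x n
    using sum.atLeastAtMost_rev[of "\<lambda>i. mu (fps_nth x i) (fps_nth y (n - i))" 0 n]
    by (simp add: atMost_atLeast0)
  then show ?thesis
    by (simp add: fun_eq_iff fps_eq_iff trivial_deformation_nth fps_extend_nth)
qed

lemma fps_bilinear_trivial_deformation: "fps_bilinear trivial_deformation"
proof -
  have "fps_linear (trivial_deformation x)" for x
    unfolding trivial_deformation_left by (rule fps_linear_extend[OF linear_mu_right])
  moreover have "fps_linear (\<lambda>x. trivial_deformation x y)" for y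
    unfolding trivial_deformation_right by (rule fps_linear_extend[OF linear_mu_left])
  ultimately show ?thesis by (simp add: fps_bilinear_def)
qed

text \<open>Bihom-associativity passes from \<open>A\<close> to \<open>A[[t]]\<close> with the structure maps acting coefficientwise.\<close>

lemma trivial_deformation_assoc:
  "trivial_deformation (Abs_fps (\<lambda>n. alpha (fps_nth x n))) (trivial_deformation y z) =
   trivial_deformation (trivial_deformation x y) (Abs_fps (\<lambda>n. beta (fps_nth z n)))"
  using triangle_sum_assoc[of "\<lambda>i j k. mu (mu (fps_nth x i) (fps_nth y j)) (beta (fps_nth z k))"]
  by (simp add: fps_eq_iff trivial_deformation_nth klinear_sum[OF linear_mu_left]
      klinear_sum[OF linear_mu_right] bihom_assoc)

lemma formal_deformation_trivial: "formal_deformation trivial_deformation"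
proof -
  define m where "m i = cochain2 (if i = 0 then mu else (\<lambda>_ _. 0))" for i :: nat
  have m: "m i \<in> cochains 2" for i
    unfolding m_def by (rule cochain2_in) (simp add: equivariant2_mu equivariant2_zero)
  have m0: "m 0 [a, b] = mu a b" for a b
    by (simp add: m_def cochain2_def)
  have const: "trivial_deformation (fps_const a) (fps_const b) = Abs_fps (\<lambda>i. m i [a, b])" for a b
    unfolding trivial_deformation_left fps_extend_const[OF linear_mu_right]
    by (auto simp: fps_eq_iff m_def cochain2_def)
  have al: "fps_const (alpha a) = Abs_fps (\<lambda>n. alpha (fps_nth (fps_const a) n))"
    and be: "fps_const (beta a) = Abs_fps (\<lambda>n. beta (fps_nth (fps_const a) n))" for a
    by (auto simp: fps_eq_iff klinear_zero[OF linear_alpha] klinear_zero[OF linear_beta])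
  show ?thesis
    unfolding formal_deformation_def al be
    using fps_bilinear_trivial_deformation m m0 const trivial_deformation_assoc by blast
qed

section \<open>The first obstruction is a cocycle\<close>

text \<open>
  A bilinear map of order at least \<open>n\<close> on constants has the form \<open>t\<^sup>n\<close> times a bilinear
  map, and the constant term of the latter sees only the constant terms of its arguments.
\<close>

lemma fps_bilinear_lowest_coeff:
  assumes "fps_bilinear T" and "\<And>a b k. k < n \<Longrightarrow> fps_nth (T (fps_const a) (fps_const b)) k = 0"
  shows "fps_nth (T x y) n = fps_nth (T (fps_const (fps_nth x 0)) (fps_const (fps_nth y 0))) n"
proof -
  have lin: "fps_linear (T u)" "fps_linear (\<lambda>v. T v u)" for u
    using assms(1) by (auto simp: fps_bilinear_def)
  have *: "fps_nth (T u (fps_const b)) k = (if k = n then fps_nth (T (fps_const (fps_nth u 0)) (fps_const b)) n else 0)"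
    if "k \<le> n" for u b k
  proof -
    have "fps_nth (T u (fps_const b)) k = (\<Sum>i\<le>k. fps_nth (T (fps_const (fps_nth u i)) (fps_const b)) (k - i))"
      using fps_linear_nth[OF lin(2)] .
    also have "\<dots> = (\<Sum>i\<le>k. if i = 0 then (if k = n then fps_nth (T (fps_const (fps_nth u 0)) (fps_const b)) n else 0) else 0)"
      using that by (intro sum.cong) (auto intro: assms(2))
    finally show ?thesis by simp
  qed
  have "fps_nth (T x y) n = (\<Sum>i\<le>n. fps_nth (T x (fps_const (fps_nth y i))) (n - i))"
    using fps_linear_nth[OF lin(1)] .
  also have "\<dots> = (\<Sum>i\<le>n. if i = 0 then fps_nth (T (fps_const (fps_nth x 0)) (fps_const (fps_nth y 0))) n else 0)"
    by (intro sum.cong) (auto simp: *[of _ x])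
  finally show ?thesis by simp
qed

text \<open>The failure of \<open>fps_extend P\<close> to be multiplicative from \<open>M\<close> to the constant product.\<close>

definition defect :: "(nat \<Rightarrow> 'a \<Rightarrow> 'a) \<Rightarrow> ('a fps \<Rightarrow> 'a fps \<Rightarrow> 'a fps) \<Rightarrow> 'a fps \<Rightarrow> 'a fps \<Rightarrow> 'a fps" where
  "defect P M x y =
     fps_extend P (M x y) - trivial_deformation (fps_extend P x) (fps_extend P y)"

lemma fps_bilinear_defect:
  assumes "\<And>i. klinear (P i)" "fps_bilinear M"
  shows "fps_bilinear (defect P M)"
proof -
  interpret pair: module_pair fps_scale fps_scale
    by (simp add: module_pair_def module_fps_scale)
  have ext: "fps_linear (fps_extend P)"
    by (rule fps_linear_extend[OF assms(1)])
  have M: "fps_linear (M x)" "fps_linear (\<lambda>x. M x y)" for x y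
    using assms(2) by (auto simp: fps_bilinear_def)
  have T: "fps_linear (trivial_deformation x)" "fps_linear (\<lambda>x. trivial_deformation x y)" for x y
    using fps_bilinear_trivial_deformation by (auto simp: fps_bilinear_def)
  show ?thesis
    unfolding fps_bilinear_def defect_def
    using pair.module_hom_sub[OF module_hom_compose[OF M(1) ext] module_hom_compose[OF ext T(1)]]
      pair.module_hom_sub[OF module_hom_compose[OF M(2) ext] module_hom_compose[OF ext T(2)]]
    by (simp add: comp_def)
qed

text \<open>
  Both sides of the associativity of \<open>M\<close> are pushed through \<open>fps_extend P\<close>; the triple
  products of the constant product cancel, and the terms containing the defect leave exactly
  the four terms of the coboundary of its lowest coefficient.
\<close>

lemma defect_lowest_coeff_cocycle:
  assumes P: "\<And>i. equivariant1 (P i)" "P 0 = (\<lambda>a. a)"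
    and M: "formal_deformation M"
    and low: "\<And>a b k. k < n \<Longrightarrow> fps_nth (defect P M (fps_const a) (fps_const b)) k = 0"
  defines "D \<equiv> \<lambda>a b. fps_nth (defect P M (fps_const a) (fps_const b)) n"
  shows "mu (alpha a) (D b c) + D (alpha a) (mu b c) = mu (D a b) (beta c) + D (mu a b) (beta c)"
proof -
  let ?E = "defect P M" and ?\<phi> = "fps_extend P"
  have lin: "klinear (P i)" for i
    using P(1) by (simp add: equivariant1_def)
  have bil: "fps_bilinear M"
    and assoc: "M (fps_const (alpha a)) (M (fps_const b) (fps_const c)) =
                M (M (fps_const a) (fps_const b)) (fps_const (beta c))"
    and M0: "fps_nth (M (fps_const u) (fps_const v)) 0 = mu u v" for u v
    using M by (auto simp: formal_deformation_def)
  have E: "fps_nth (?E x y) n = D (fps_nth x 0) (fps_nth y 0)" for x y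
    unfolding D_def by (rule fps_bilinear_lowest_coeff[OF fps_bilinear_defect[OF lin bil] low])
  have \<phi>M: "?\<phi> (M x y) = ?E x y + trivial_deformation (?\<phi> x) (?\<phi> y)" for x y
    by (simp add: defect_def)
  have T_add: "trivial_deformation x (y + z) = trivial_deformation x y + trivial_deformation x z"
    "trivial_deformation (x + y) z = trivial_deformation x z + trivial_deformation y z" for x y z
    using fps_bilinear_trivial_deformation by (auto simp: fps_bilinear_def fps_linear_iff)
  have \<phi>0: "fps_nth (?\<phi> (fps_const u)) 0 = u" for u
    by (simp add: fps_extend_const[OF lin] P(2))
  \<comment> \<open>A product with a series of order at least \<open>n\<close> has a single term in degree \<open>n\<close>.\<close>
  have TE: "fps_nth (trivial_deformation x (?E (fps_const u) (fps_const v))) n = mu (fps_nth x 0) (D u v)" for x u v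
  proof -
    have "fps_nth (trivial_deformation x (?E (fps_const u) (fps_const v))) n
        = (\<Sum>i\<le>n. if i = 0 then mu (fps_nth x 0) (D u v) else 0)"
      unfolding trivial_deformation_nth by (rule sum.cong) (auto simp: low D_def)
    then show ?thesis by simp
  qed
  have ET: "fps_nth (trivial_deformation (?E (fps_const u) (fps_const v)) x) n = mu (D u v) (fps_nth x 0)" for x u v
  proof -
    have "fps_nth (trivial_deformation (?E (fps_const u) (fps_const v)) x) n
        = (\<Sum>i\<le>n. if i = n then mu (D u v) (fps_nth x 0) else 0)"
      unfolding trivial_deformation_nth by (rule sum.cong) (auto simp: low D_def)
    then show ?thesis by simp
  qed
  have al: "?\<phi> (fps_const (alpha a)) = Abs_fps (\<lambda>n. alpha (fps_nth (?\<phi> (fps_const a)) n))"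
    and be: "?\<phi> (fps_const (beta c)) = Abs_fps (\<lambda>n. beta (fps_nth (?\<phi> (fps_const c)) n))"
    using P(1) by (simp_all add: fps_extend_const[OF lin] equivariant1_def)
  let ?T = "trivial_deformation (?\<phi> (fps_const (alpha a))) (trivial_deformation (?\<phi> (fps_const b)) (?\<phi> (fps_const c)))"
  have "fps_nth (?\<phi> (M (fps_const (alpha a)) (M (fps_const b) (fps_const c)))) n
      = D (alpha a) (mu b c) + (mu (alpha a) (D b c) + fps_nth ?T n)"
    by (simp add: \<phi>M T_add E TE M0 \<phi>0)
  moreover have "fps_nth (?\<phi> (M (M (fps_const a) (fps_const b)) (fps_const (beta c)))) n
      = D (mu a b) (beta c) + (mu (D a b) (beta c) + fps_nth ?T n)"
    by (simp add: \<phi>M T_add E ET M0 \<phi>0) (simp add: al be trivial_deformation_assoc)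
  ultimately show ?thesis
    using assoc by (simp add: add.commute)
qed

section \<open>Trivialising a deformation order by order\<close>

lemma defect_nth:
  assumes "\<And>i. klinear (P i)"
    and "M (fps_const a) (fps_const b) = Abs_fps (\<lambda>i. m i [a, b])"
  shows "fps_nth (defect P M (fps_const a) (fps_const b)) n =
    (\<Sum>i\<le>n. P i (m (n - i) [a, b])) - (\<Sum>i\<le>n. mu (P i a) (P (n - i) b))"
  by (simp add: defect_def assms fps_extend_const trivial_deformation_nth fps_extend_nth)

text \<open>
  The sequence \<open>P\<close> is built by well-founded dependent choice. At order \<open>0\<close> it is the
  identity; at order \<open>n > 0\<close> the defect of the part already chosen is a cocycle in
  degree \<open>n\<close>, and \<open>P n\<close> is a map whose coboundary it is.
\<close>

theorem rigid_if_cohomology_trivial: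
  assumes H: "Hoch_cohomology 2 = {Hoch_cohomology_zero 2}"
  shows rigid
  unfolding rigid_def
proof (intro allI impI)
  fix M
  assume M: "formal_deformation M"
  then obtain m where m: "\<And>i. m i \<in> cochains 2" "\<And>a b. m 0 [a, b] = mu a b"
    and Mconst: "\<And>a b. M (fps_const a) (fps_const b) = Abs_fps (\<lambda>i. m i [a, b])"
    by (auto simp: formal_deformation_def)
  define d where "d f n a b = (\<Sum>i\<le>n. f i (m (n - i) [a, b])) - (\<Sum>i\<le>n. mu (f i a) (f (n - i) b))"
    for f :: "nat \<Rightarrow> 'a \<Rightarrow> 'a" and n :: nat and a b
  have d: "fps_nth (defect f M (fps_const a) (fps_const b)) n = d f n a b"
    if "\<And>i. klinear (f i)" for f n a b
    unfolding d_def by (intro defect_nth that Mconst)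
  have d_cong: "d f n = d g n" if "\<And>k. k \<le> n \<Longrightarrow> f k = g k" for f g n
    using that by (simp add: d_def fun_eq_iff)
  define good where "good f n r \<longleftrightarrow>
      equivariant1 r \<and> (n = 0 \<longrightarrow> r = (\<lambda>a. a)) \<and> (\<forall>a b. d (f(n := r)) n a b = 0)"
    for f :: "nat \<Rightarrow> 'a \<Rightarrow> 'a" and n :: nat and r
  \<comment> \<open>\<open>good f n r\<close>: given \<open>f\<close> below \<open>n\<close>, the map \<open>r\<close> is an admissible choice of order \<open>n\<close>.\<close>
  have "\<exists>P. \<forall>n. good P n (P n)"
  proof (rule dependent_wf_choice[OF wf_less_than])
    fix f g :: "nat \<Rightarrow> 'a \<Rightarrow> 'a" and n r
    assume "\<And>k. (k, n) \<in> less_than \<Longrightarrow> f k = g k"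
    then have "d (f(n := r)) n = d (g(n := r)) n"
      by (intro d_cong) auto
    then show "good f n r = good g n r"
      by (simp add: good_def)
  next
    fix n and f :: "nat \<Rightarrow> 'a \<Rightarrow> 'a"
    assume IH: "\<And>k. (k, n) \<in> less_than \<Longrightarrow> good f k (f k)"
    show "\<exists>r. good f n r"
    proof (cases "n = 0")
      case True
      then have "good f n (\<lambda>a. a)"
        by (simp add: good_def equivariant1_id d_def m)
      then show ?thesis by (rule exI[where P = "good f n"])
    next
      case False
      \<comment> \<open>From order \<open>n\<close> on nothing is known about \<open>f\<close>, so it is cut off to obtain a
          sequence that is equivariant throughout.\<close>
      define g where "g i = (if i < n then f i else (\<lambda>_. 0))" for i
      have g: "equivariant1 (g i)" for i
        using IH by (auto simp: g_def good_def equivariant1_zero)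
      have lin: "klinear (g i)" for i
        using g by (simp add: equivariant1_def)
      have g0: "g 0 = (\<lambda>a. a)"
        using IH[of 0] False by (simp add: g_def good_def)
      have low: "d g k a b = 0" if "k < n" for k a b
      proof -
        have "d g k = d (f(k := f k)) k"
          using that by (intro d_cong) (auto simp: g_def)
        then show ?thesis
          using IH[of k] that by (simp add: good_def)
      qed
      have "mu (alpha a) (d g n b c) + d g n (alpha a) (mu b c) = mu (d g n a b) (beta c) + d g n (mu a b) (beta c)" for a b c
        using defect_lowest_coeff_cocycle[where P = g, OF g g0 M, of n a b c] by (simp add: d[OF lin] low)
      moreover have "equivariant2 (d g n)"
      proof -
        have "equivariant2 (\<lambda>a b. g i (m (n - i) [a, b]))" for i
          using equivariant2_compose[OF g equivariant2_cochain[OF m(1)]] .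
        moreover have "equivariant2 (\<lambda>a b. mu (g i a) (g (n - i) b))" for i
          by (rule equivariant2_mu_compose[OF g g])
        ultimately show ?thesis
          unfolding d_def by (rule equivariant2_diff[OF equivariant2_sum equivariant2_sum])
      qed
      ultimately obtain r where r: "equivariant1 r"
        "\<And>a b. d g n a b = mu a (r b) + mu (r a) b - r (mu a b)"
        using coboundary_if_cohomology_trivial[OF H, of "d g n"] by metis
      have "d (f(n := r)) n a b = 0" for a b
      proof -
        have "d (f(n := r)) n = d (g(n := r)) n"
          by (rule d_cong) (auto simp: g_def)
        moreover have "d (g(n := r)) n a b = d g n a b - (mu a (r b) + mu (r a) b - r (mu a b))"
        proof -
          obtain k where k: "n = Suc k" using False by (cases n) auto
          have gn: "g n = (\<lambda>_. 0)" by (simp add: g_def)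
          have "(\<Sum>i\<le>n. (g(n := r)) i (m (n - i) [a, b])) = (\<Sum>i\<le>n. g i (m (n - i) [a, b])) + r (mu a b)"
            using gn by (simp add: k m)
          moreover have "(\<Sum>i\<le>n. mu ((g(n := r)) i a) ((g(n := r)) (n - i) b)) =
              (\<Sum>i\<le>n. mu (g i a) (g (n - i) b)) + mu a (r b) + mu (r a) b"
          proof -
            have "(\<Sum>i\<le>n. mu ((g(n := r)) i a) ((g(n := r)) (n - i) b)) =
              (\<Sum>i\<le>n. mu (g i a) (g (n - i) b) + ((if i = 0 then mu a (r b) else 0) + (if i = n then mu (r a) b else 0)))"
              \<comment> \<open>The two ends \<open>i = 0\<close> and \<open>i = n\<close> are distinct as \<open>n > 0\<close>, and there \<open>g\<close>
                  contributes \<open>0\<close> because \<open>g n = 0\<close>.\<close>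
              using False gn g0 by (intro sum.cong) auto
            then show ?thesis by (simp add: sum.distrib)
          qed
          ultimately show ?thesis by (simp add: d_def)
        qed
        ultimately show ?thesis by (simp add: r(2))
      qed
      with r(1) False have "good f n r" by (simp add: good_def)
      then show ?thesis by (rule exI[where P = "good f n"])
    qed
  qed
  then obtain P where P: "\<And>n. good P n (P n)" by blast
  have eqv: "equivariant1 (P i)" for i
    using P[of i] by (simp add: good_def)
  then have lin: "klinear (P i)" for i
    by (simp add: equivariant1_def)
  have P0: "P 0 = (\<lambda>a. a)"
    using P[of 0] by (simp add: good_def)
  have "defect P M (fps_const a) (fps_const b) = 0" for a b
    using P by (simp add: fps_eq_iff d[OF lin] good_def)
  then have hom: "fps_extend P (M (fps_const a) (fps_const b)) =
      trivial_deformation (fps_extend P (fps_const a)) (fps_extend P (fps_const b))" for a b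
    by (simp add: defect_def)
  have "formal_automorphism (fps_extend P)"
    unfolding formal_automorphism_def
  proof (intro conjI exI[of _ "\<lambda>i. cochain1 (P i)"] allI)
    show "fps_linear (fps_extend P)" by (rule fps_linear_extend[OF lin])
    show "bij (fps_extend P)" by (rule bij_fps_extend) (rule lin, rule P0)
  qed (simp_all add: cochain1_in[OF eqv, simplified] cochain1_def P0 fps_extend_const[OF lin])
  with M hom formal_deformation_trivial
  show "equivalent_deformations M trivial_deformation"
    unfolding equivalent_deformations_def by blast
qed

end

theorem theorem5p6:
  fixes scale :: "'k::field_char_0 \<Rightarrow> 'a::ab_group_add \<Rightarrow> 'a"
    and mu :: "'a \<Rightarrow> 'a \<Rightarrow> 'a" and alpha beta :: "'a \<Rightarrow> 'a"
  assumes "bihom_assoc_algebra scale mu alpha beta"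
    and "bihom_assoc_algebra.Hoch_cohomology scale mu alpha beta 2 =
         {bihom_assoc_algebra.Hoch_cohomology_zero scale mu alpha beta 2}"
  shows "bihom_assoc_algebra.rigid scale mu alpha beta"
  using bihom_assoc_algebra.rigid_if_cohomology_trivial[OF assms] .

end
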